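(* Let $w_{102}(n)$ be the number of weak ascent sequences of length $n$ that avoid the pattern $102$. The generating function $f=f(x)=\sum_{n\ge 0} w_{102}(n)\,x^n$ satisfies, as a formal power series, $$f=1+x(1-x)f^3.$$
   Context: For a word $u=u_1\cdots u_\ell$ of non-negative integers, $\mathrm{wasc}(u)$ denotes the number of weak ascents of $u$, i.e. the number of positions $j$ with $1\le j\le \ell-1$ and $u_j\le u_{j+1}$. A weak ascent sequence of length $n\ge 1$ is a word $w=w_1w_2\cdots w_n$ of non-negative integers with $w_1=0$ and $w_i\le \mathrm{wasc}(w_1\cdots w_{i-1})+1$ for $i=2,\dots,n$; the empty word is the unique weak ascent sequence of length $0$ (and it avoids every nonempty pattern). The word $w$ contains a pattern $p=p_1\cdots p_k$ if there are indices $i_1<\cdots<i_k$ such that $w_{i_1}\cdots w_{i_k}$ is order-isomorphic to $p$ (for all $a,b$: $w_{i_a}<w_{i_b}$ iff $p_a<p_b$, and $w_{i_a}=w_{i_b}$ iff $p_a=p_b$); otherwise $w$ avoids $p$. *)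

theory Defs
  imports "HOL-Computational_Algebra.Formal_Power_Series"
begin

text \<open>Words are lists of naturals. List positions start at 0, so the letter \<open>w\<^sub>i\<close> of the
  mathematical text is \<open>w ! (i - 1)\<close> and \<open>take i w\<close> is the prefix preceding \<open>w ! i\<close>.\<close>

definition wasc :: "nat list \<Rightarrow> nat" where
  "wasc u = card {j. Suc j < length u \<and> u ! j \<le> u ! Suc j}"

definition weak_ascent_seq :: "nat list \<Rightarrow> bool" where
  "weak_ascent_seq w \<longleftrightarrow>
     (w \<noteq> [] \<longrightarrow> w ! 0 = 0) \<and>
     (\<forall>i. 1 \<le> i \<and> i < length w \<longrightarrow> w ! i \<le> wasc (take i w) + 1)"

definition contains_pattern :: "nat list \<Rightarrow> nat list \<Rightarrow> bool" where
  "contains_pattern w p \<longleftrightarrow>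
     (\<exists>f :: nat \<Rightarrow> nat.
        strict_mono_on {..<length p} f \<and>
        (\<forall>a<length p. f a < length w) \<and>
        (\<forall>a<length p. \<forall>b<length p.
           (w ! f a < w ! f b \<longleftrightarrow> p ! a < p ! b) \<and>
           (w ! f a = w ! f b \<longleftrightarrow> p ! a = p ! b)))"

definition avoids_pattern :: "nat list \<Rightarrow> nat list \<Rightarrow> bool" where
  "avoids_pattern w p \<longleftrightarrow> \<not> contains_pattern w p"

definition weak_ascent_avoiders :: "nat list \<Rightarrow> nat \<Rightarrow> nat list set" where
  "weak_ascent_avoiders p n = {w. length w = n \<and> weak_ascent_seq w \<and> avoids_pattern w p}"

definition w102 :: "nat \<Rightarrow> nat" where
  "w102 n = card (weak_ascent_avoiders [1, 0, 2] n)"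

definition w102_gf :: "int fps" where
  "w102_gf = Abs_fps (\<lambda>n. int (w102 n))"

text \<open>The sets being counted are finite, so \<open>card\<close> is the true number of elements.\<close>

lemma wasc_le_length: "wasc u \<le> length u - 1"
proof -
  have "{j. Suc j < length u \<and> u ! j \<le> u ! Suc j} \<subseteq> {..<length u - 1}" by auto
  then have "card {j. Suc j < length u \<and> u ! j \<le> u ! Suc j} \<le> card {..<length u - 1}"
    by (intro card_mono) auto
  then show ?thesis by (simp add: wasc_def)
qed

lemma weak_ascent_seq_nth_le:
  assumes "weak_ascent_seq w" "i < length w"
  shows "w ! i \<le> i"
proof (cases "i = 0")
  case True
  with assms show ?thesis by (auto simp: weak_ascent_seq_def)
next
  case False
  with assms have "w ! i \<le> wasc (take i w) + 1" by (auto simp: weak_ascent_seq_def)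
  with wasc_le_length[of "take i w"] False assms(2) show ?thesis by simp
qed

lemma finite_weak_ascent_avoiders: "finite (weak_ascent_avoiders p n)"
proof (rule finite_subset)
  show "weak_ascent_avoiders p n \<subseteq> {w. set w \<subseteq> {..n} \<and> length w = n}"
    using weak_ascent_seq_nth_le
    by (fastforce simp: weak_ascent_avoiders_def in_set_conv_nth)
  show "finite {w. set w \<subseteq> {..n} \<and> length w = n}"
    by (rule finite_lists_length_eq) simp
qed

end

theory Submission
  imports Defs "HOL-Library.Sublist"
begin

text \<open>The \<open>102\<close>-avoiding weak ascent sequences are the \<open>102\<close>-avoiding words whose letter at
  position \<open>i\<close> (from \<open>0\<close>) is at most \<open>i\<close>. Cutting a \<open>102\<close>-avoiding word with first letter \<open>d\<close>
  before the first letter below \<open>d\<close> leaves two independent \<open>102\<close>-avoiding words, one over letters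
  at least \<open>d\<close> and one over \<open>{0..d}\<close> not starting with \<open>d\<close>. With \<open>t = x (1 - x)\<close>, the generating
  functions \<open>U\<^sub>d\<close> of the words over \<open>{0..d}\<close> and \<open>F\<^sub>h\<close> of the words bounded by \<open>h + i\<close> then satisfy
  \<open>U\<^sub>d = 1 + t \<Sum>\<^sub>e U\<^sub>e U\<^sub>d\<^sub>-\<^sub>e\<close> and \<open>F\<^sub>h = 1 + t \<Sum>\<^sub>d U\<^sub>d F\<^sub>h\<^sub>+\<^sub>1\<^sub>-\<^sub>d\<close>. The second system has a unique
  solution, found by the kernel method, and its entry at \<open>h = 0\<close> is the root of \<open>g = 1 + t g\<^sup>3\<close>.\<close>

unbundle fps_syntax

section \<open>Avoidance of 102 through subsequences of letters\<close>

definition avoids102 :: "nat list \<Rightarrow> bool" where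
  "avoids102 w \<longleftrightarrow> (\<forall>a b c. subseq [b, a, c] w \<longrightarrow> a < b \<longrightarrow> c \<le> b)"

lemma avoids102D: "avoids102 w \<Longrightarrow> subseq [b, a, c] w \<Longrightarrow> a < b \<Longrightarrow> c \<le> b"
  by (auto simp: avoids102_def)

lemma subseq_triple_nth:
  assumes "i < j" "j < k" "k < length w"
  shows "subseq [w ! i, w ! j, w ! k] w"
proof -
  have "w = take i w @ w ! i # drop (Suc i) w"
    using assms by (simp add: id_take_nth_drop)
  moreover have "drop (Suc i) w = take (j - Suc i) (drop (Suc i) w) @ w ! j # drop (Suc j) w"
    using assms id_take_nth_drop[of "j - Suc i" "drop (Suc i) w"] by simp
  moreover have "w ! k \<in> set (drop (Suc j) w)"
    using assms by (auto simp: in_set_conv_nth intro!: exI[of _ "k - Suc j"])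
  then have "subseq [w ! k] (drop (Suc j) w)"
    by (simp add: subseq_singleton_left)
  ultimately show ?thesis
    by (metis list_emb_append2 subseq_Cons2)
qed

lemma subseq_triple_imp_nth:
  assumes "subseq [b, a, c] w"
  obtains i j k where "i < j" "j < k" "k < length w" "w ! i = b" "w ! j = a" "w ! k = c"
proof -
  obtain w1 w2 w3 w4 where w: "w = w1 @ b # w2 @ a # w3 @ c # w4"
    using assms by (auto dest!: list_emb_ConsD)
  show ?thesis
    by (rule that[of "length w1" "length w1 + 1 + length w2"
          "length w1 + 1 + length w2 + 1 + length w3"])
       (auto simp: w nth_append)
qed

lemma avoids_pattern_102_iff: "avoids_pattern w [1, 0, 2] \<longleftrightarrow> avoids102 w"
proof
  assume av: "avoids_pattern w [1, 0, 2]"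
  show "avoids102 w"
    unfolding avoids102_def
  proof (intro allI impI, rule ccontr)
    fix a b c assume *: "subseq [b, a, c] w" "a < b" "\<not> c \<le> b"
    obtain i j k where ijk: "i < j" "j < k" "k < length w" "w ! i = b" "w ! j = a" "w ! k = c"
      using subseq_triple_imp_nth[OF *(1)] by blast
    define f where "f = (\<lambda>n::nat. if n = 0 then i else if n = 1 then j else k)"
    have "contains_pattern w [1, 0, 2]"
      unfolding contains_pattern_def
    proof (intro exI[of _ f] conjI)
      show "strict_mono_on {..<length [1, 0, 2::nat]} f"
        using ijk by (auto simp: strict_mono_on_def f_def)
      show "\<forall>a<length [1, 0, 2::nat]. f a < length w"
        using ijk by (auto simp: f_def)
      show "\<forall>a<length [1, 0, 2::nat]. \<forall>b<length [1, 0, 2::nat].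
          (w ! f a < w ! f b \<longleftrightarrow> [1, 0, 2::nat] ! a < [1, 0, 2] ! b) \<and>
          (w ! f a = w ! f b \<longleftrightarrow> [1, 0, 2::nat] ! a = [1, 0, 2] ! b)"
        using ijk * by (auto simp: f_def less_Suc_eq numeral_3_eq_3)
    qed
    with av show False by (simp add: avoids_pattern_def)
  qed
next
  assume av: "avoids102 w"
  show "avoids_pattern w [1, 0, 2]"
    unfolding avoids_pattern_def contains_pattern_def
  proof (rule notI, elim exE conjE)
    fix f :: "nat \<Rightarrow> nat"
    assume f: "strict_mono_on {..<length [1, 0, 2::nat]} f"
      "\<forall>a<length [1, 0, 2::nat]. f a < length w"
      and iso: "\<forall>a<length [1, 0, 2::nat]. \<forall>b<length [1, 0, 2::nat].
          (w ! f a < w ! f b \<longleftrightarrow> [1, 0, 2::nat] ! a < [1, 0, 2] ! b) \<and>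
          (w ! f a = w ! f b \<longleftrightarrow> [1, 0, 2::nat] ! a = [1, 0, 2] ! b)"
    have "f 0 < f 1" "f 1 < f 2"
      using f(1) by (auto simp: strict_mono_on_def)
    then have "subseq [w ! f 0, w ! f 1, w ! f 2] w"
      using f(2) by (intro subseq_triple_nth) auto
    moreover have "w ! f 1 < w ! f 0" "w ! f 0 < w ! f 2"
      using iso[rule_format, of 1 0] iso[rule_format, of 0 2] by auto
    ultimately show False
      using avoids102D[OF av] by fastforce
  qed
qed

section \<open>Weak ascent sequences as words with bounded letters\<close>

text \<open>The bound varies with the position so that one recursion serves both families: constant
  bounds give \<open>U d\<close>, the bounds \<open>h + i\<close> give \<open>F h\<close>.\<close>

definition bounded_avoiders :: "(nat \<Rightarrow> nat) \<Rightarrow> nat \<Rightarrow> nat list set" where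
  "bounded_avoiders \<beta> n = {w. length w = n \<and> avoids102 w \<and> (\<forall>i<n. w ! i \<le> \<beta> i)}"

text \<open>After the first descent, whose top is \<open>w ! j \<le> j\<close>, avoidance of \<open>102\<close> keeps all letters
  at most \<open>w ! j\<close>, and the prefix up to the descent already has \<open>j\<close> weak ascents.\<close>

lemma weak_ascent_avoiders_102: "weak_ascent_avoiders [1, 0, 2] n = bounded_avoiders (\<lambda>i. i) n"
proof -
  have "weak_ascent_seq w" if av: "avoids102 w" and le: "\<forall>i<length w. w ! i \<le> i" for w
    unfolding weak_ascent_seq_def
  proof (intro conjI impI allI)
    show "w ! 0 = 0" if "w \<noteq> []" using le that by auto
    fix i assume i: "1 \<le> i \<and> i < length w"
    let ?A = "{j. Suc j < length (take i w) \<and> take i w ! j \<le> take i w ! Suc j}"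
    have fin: "finite ?A" by (rule finite_subset[of _ "{..<length w}"]) auto
    show "w ! i \<le> wasc (take i w) + 1"
    proof (cases "\<exists>j. Suc j < i \<and> w ! Suc j < w ! j")
      \<comment> \<open>With no descent before position \<open>i\<close>, all \<open>i - 1\<close>
        adjacent pairs of the prefix are weak ascents, so the allowed maximum is at least
        \<open>i\<close>.\<close>
      case False
      then have "w ! l \<le> w ! Suc l" if "Suc l < i" for l
        using that by (meson not_less)
      then have "{..<i - 1} \<subseteq> ?A" using i by auto
      then have "i - 1 \<le> wasc (take i w)"
        using card_mono[OF fin, of "{..<i - 1}"] unfolding wasc_def by simp
      with le[rule_format, of i] i show ?thesis by linarith
    next
      case True
      define j where "j = (LEAST j. Suc j < i \<and> w ! Suc j < w ! j)"
      have j: "Suc j < i" "w ! Suc j < w ! j"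
        using LeastI_ex[OF True] by (auto simp: j_def)
      have "\<not> w ! Suc l < w ! l" if "l < j" for l
        using not_less_Least[of l "\<lambda>j. Suc j < i \<and> w ! Suc j < w ! j"] that j
        by (auto simp: j_def)
      then have "{..<j} \<subseteq> ?A" using i j by (auto simp: not_less)
      then have "j \<le> wasc (take i w)"
        using card_mono[OF fin, of "{..<j}"] unfolding wasc_def by simp
      moreover have "w ! i \<le> w ! j"
        using subseq_triple_nth[of j "Suc j" i w] avoids102D[OF av] i j by blast
      moreover have "w ! j \<le> j" using le i j by simp
      ultimately show ?thesis by linarith
    qed
  qed
  then show ?thesis
    unfolding weak_ascent_avoiders_def bounded_avoiders_def avoids_pattern_102_iff
    by (auto intro: weak_ascent_seq_nth_le)
qed

lemma finite_bounded_avoiders: "finite (bounded_avoiders \<beta> n)"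
proof (rule finite_subset)
  show "bounded_avoiders \<beta> n \<subseteq> {w. set w \<subseteq> (\<Union>i<n. {..\<beta> i}) \<and> length w = n}"
    by (fastforce simp: bounded_avoiders_def in_set_conv_nth)
  show "finite {w. set w \<subseteq> (\<Union>i<n. {..\<beta> i}) \<and> length w = n}"
    by (rule finite_lists_length_eq) simp
qed

lemma bounded_avoiders_0: "bounded_avoiders \<beta> 0 = {[]}"
  by (auto simp: bounded_avoiders_def avoids102_def)

section \<open>Cutting a word before the first letter below its initial letter\<close>

lemma avoids102_map_add: "avoids102 (map ((+) d) u) \<longleftrightarrow> avoids102 u"
proof
  assume av: "avoids102 (map ((+) d) u)"
  show "avoids102 u"
    unfolding avoids102_def
  proof (intro allI impI)
    fix a b c assume "subseq [b, a, c] u" "a < b"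
    then show "c \<le> b"
      using subseq_map[of "[b, a, c]" u "(+) d"] avoids102D[OF av, of "d + b" "d + a" "d + c"]
      by simp
  qed
next
  assume av: "avoids102 u"
  show "avoids102 (map ((+) d) u)"
    unfolding avoids102_def
  proof (intro allI impI)
    fix a b c assume *: "subseq [b, a, c] (map ((+) d) u)" "a < b"
    obtain i j k where ijk: "i < j" "j < k" "k < length u"
      "map ((+) d) u ! i = b" "map ((+) d) u ! j = a" "map ((+) d) u ! k = c"
      using subseq_triple_imp_nth[OF *(1)] by (metis length_map)
    with *(2) show "c \<le> b"
      using avoids102D[OF av subseq_triple_nth[of i j k u]] by auto
  qed
qed

lemma avoids102_subseq: "avoids102 w \<Longrightarrow> subseq u w \<Longrightarrow> avoids102 u"
  unfolding avoids102_def by (meson subseq_order.trans)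

lemma subseq_triple_append:
  "subseq [b, a, c] (u @ v) \<longleftrightarrow> subseq [b, a, c] u \<or> subseq [b, a] u \<and> subseq [c] v \<or>
     subseq [b] u \<and> subseq [a, c] v \<or> subseq [b, a, c] v"
  (is "?L \<longleftrightarrow> ?R")
proof
  assume ?L
  then obtain xs ys where *: "[b, a, c] = xs @ ys" "subseq xs u" "subseq ys v"
    by (auto elim: subseq_appendE)
  from *(1) have "xs = [] \<or> xs = [b] \<or> xs = [b, a] \<or> xs = [b, a, c]"
    by (auto simp: Cons_eq_append_conv)
  with * show ?R by auto
next
  assume ?R
  then show ?L
    using list_emb_append_mono[of "(=)" "[b, a]" u "[c]" v]
      list_emb_append_mono[of "(=)" "[b]" u "[a, c]" v]
      list_emb_append_mono[of "(=)" "[b, a, c]" u "[]" v]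
      list_emb_append_mono[of "(=)" "[]" u "[b, a, c]" v] by auto
qed

text \<open>If \<open>v\<close> is nonempty, \<open>d\<close> followed by \<open>hd v\<close> is a
  descent, which caps the rest of \<open>v\<close> at \<open>d\<close>. Conversely, an occurrence
  that starts in \<open>d # u\<close> cannot end in \<open>v\<close>, since its first letter is at
  least \<open>d\<close> and its last at most \<open>d\<close>. Nor can it start with the leading
  \<open>d\<close> and stay inside \<open>d # u\<close>, where no letter is smaller.\<close>

lemma avoids102_decompose:
  assumes u: "\<forall>x\<in>set u. d \<le> x" and v: "v = [] \<or> hd v < d"
  shows "avoids102 (d # u @ v) \<longleftrightarrow> avoids102 u \<and> avoids102 v \<and> (\<forall>x\<in>set v. x \<le> d)"
proof
  assume av: "avoids102 (d # u @ v)"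
  have "x \<le> d" if x: "x \<in> set v" for x
  proof (cases v)
    case (Cons y v')
    with v have y: "y < d" by simp
    show ?thesis
    proof (cases "x = y")
      case False
      with x Cons have "subseq [x] v'" by (simp add: subseq_singleton_left)
      then have "subseq [d, y, x] (d # u @ v)"
        using Cons by (simp add: list_emb_append2)
      then show ?thesis using avoids102D[OF av] y by blast
    qed (use y in simp)
  qed (use x in simp)
  then show "avoids102 u \<and> avoids102 v \<and> (\<forall>x\<in>set v. x \<le> d)"
    using avoids102_subseq[OF av, of u] avoids102_subseq[OF av, of v]
    by (auto simp: subseq_Cons' intro: subseq_order.trans)
next
  assume *: "avoids102 u \<and> avoids102 v \<and> (\<forall>x\<in>set v. x \<le> d)"
  have mem: "x \<in> set ys" if "subseq (xs @ [x]) ys" for x :: nat and xs ys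
    using list_emb_set[OF that, of x] by auto
  have mem': "x \<in> set ys" if "subseq (x # xs) ys" for x :: nat and xs ys
    using list_emb_set[OF that, of x] by auto
  show "avoids102 (d # u @ v)"
    unfolding avoids102_def
  proof (intro allI impI)
    fix a b c assume sub: "subseq [b, a, c] (d # u @ v)" and ab: "a < b"
    have sub': "subseq [b, a, c] ((d # u) @ v)" using sub by simp
    have d: "\<forall>x\<in>set (d # u). d \<le> x" using u by auto
    consider "subseq [b, a, c] (d # u)" | "c \<in> set v" "b \<in> set (d # u)" | "subseq [b, a, c] v"
      using sub' mem[of "[a]" c v] mem[of "[]" c v] mem'[of b "[a]" "d # u"]
        mem'[of b "[]" "d # u"]
      unfolding subseq_triple_append by auto
    then show "c \<le> b"
    proof cases
      case 1
      show ?thesis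
      proof (cases "subseq [b, a, c] u")
        case True
        with * ab show ?thesis using avoids102D by blast
      next
        case False
        with 1 have "b = d" "subseq [a, c] u" by (auto split: if_splits)
        with mem'[of a "[c]" u] u ab show ?thesis by fastforce
      qed
    next
      case 2
      with * d show ?thesis by fastforce
    next
      case 3
      with * ab show ?thesis using avoids102D by blast
    qed
  qed
qed

text \<open>These are the possible second factors of the cut; the condition on the head makes the
  cut unique.\<close>

definition low_avoiders :: "nat \<Rightarrow> nat \<Rightarrow> nat list set" where
  "low_avoiders d m = {v \<in> bounded_avoiders (\<lambda>_. d) m. v = [] \<or> hd v < d}"

lemma finite_low_avoiders: "finite (low_avoiders d m)"
  by (simp add: low_avoiders_def finite_bounded_avoiders)

lemma low_avoiders_0: "low_avoiders d 0 = {[]}"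
  by (auto simp: low_avoiders_def bounded_avoiders_0)

lemma bounded_avoiders_const:
  "bounded_avoiders (\<lambda>_. d) n = {w. length w = n \<and> avoids102 w \<and> (\<forall>x\<in>set w. x \<le> d)}"
  by (auto simp: bounded_avoiders_def all_set_conv_all_nth)

text \<open>A leading \<open>d\<close> is maximal, so it cannot start an occurrence of 102 and can
  be added or removed freely. For generating functions this becomes the factor
  \<open>1 - fps_X\<close>.\<close>

lemma card_low_avoiders_Suc:
  "card (bounded_avoiders (\<lambda>_. d) (Suc m)) =
     card (low_avoiders d (Suc m)) + card (bounded_avoiders (\<lambda>_. d) m)"
proof -
  have Cons: "avoids102 (d # u) \<longleftrightarrow> avoids102 u" if le: "\<forall>x\<in>set u. x \<le> d" for u
  proof
    assume "avoids102 (d # u)"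
    then show "avoids102 u" by (rule avoids102_subseq) (simp add: subseq_Cons')
  next
    assume av: "avoids102 u"
    show "avoids102 (d # u)"
      unfolding avoids102_def
    proof (intro allI impI)
      fix a b c assume *: "subseq [b, a, c] (d # u)" "a < b"
      show "c \<le> b"
      proof (cases "b = d")
        case True
        with * le list_emb_set[OF *(1), of c] show ?thesis by auto
      next
        case False
        with * av show ?thesis using avoids102D by simp
      qed
    qed
  qed
  have "bounded_avoiders (\<lambda>_. d) (Suc m) =
      low_avoiders d (Suc m) \<union> Cons d ` bounded_avoiders (\<lambda>_. d) m" (is "?L = ?R")
  proof
    show "?L \<subseteq> ?R"
    proof
      fix w assume w: "w \<in> ?L"
      then obtain x u where xu: "w = x # u"
        by (cases w) (auto simp: bounded_avoiders_const)
      show "w \<in> ?R"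
      proof (cases "x < d")
        case True
        with w xu show ?thesis by (simp add: low_avoiders_def)
      next
        case False
        with w xu have "x = d" by (auto simp: bounded_avoiders_const)
        with w xu Cons show ?thesis by (auto simp: bounded_avoiders_const)
      qed
    qed
    show "?R \<subseteq> ?L"
      using Cons by (auto simp: low_avoiders_def bounded_avoiders_const)
  qed
  moreover have "low_avoiders d (Suc m) \<inter> Cons d ` bounded_avoiders (\<lambda>_. d) m = {}"
    by (auto simp: low_avoiders_def)
  ultimately show ?thesis
    by (simp add: card_Un_disjoint finite_low_avoiders finite_bounded_avoiders card_image)
qed

text \<open>Shifting the first factor down by \<open>d\<close> preserves relative order and lowers
  its bounds by \<open>d\<close>. Monotonicity gives
  \<open>d \<le> \<beta> 0 \<le> \<beta> i\<close>, so the truncated subtraction is exact and the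
  letters of \<open>v\<close>, being at most \<open>d\<close>, satisfy every bound.\<close>

lemma bounded_avoiders_Suc_bij:
  assumes "mono \<beta>"
  shows "bij_betw (\<lambda>((d, k), (u, v)). d # map ((+) d) u @ v)
    (SIGMA (d, k) : {..\<beta> 0} \<times> {..n}.
       bounded_avoiders (\<lambda>i. \<beta> (Suc i) - d) k \<times> low_avoiders d (n - k))
    (bounded_avoiders \<beta> (Suc n))"
    (is "bij_betw ?f ?S _")
  unfolding bij_betw_def
proof (intro conjI)
  \<comment> \<open>The cut can be read off the word: shifted letters pass the test and the head of
    \<open>v\<close> fails it.\<close>
  have tw: "takeWhile (\<lambda>x. d \<le> x) (map ((+) d) u @ v) = map ((+) d) u"
    if "v = [] \<or> hd v < d" for d :: nat and u v
    using that by (cases v) (auto simp: takeWhile_append)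
  show "inj_on ?f ?S"
  proof (rule inj_onI)
    fix p q assume pq: "p \<in> ?S" "q \<in> ?S" "?f p = ?f q"
    obtain d k u v where p: "p = ((d, k), (u, v))" by (metis surj_pair)
    obtain d' k' u' v' where q: "q = ((d', k'), (u', v'))" by (metis surj_pair)
    have d: "d' = d" using pq(3) p q by simp
    have eq: "map ((+) d) u @ v = map ((+) d) u' @ v'" using pq(3) unfolding p q d by simp
    have v: "v = [] \<or> hd v < d" "v' = [] \<or> hd v' < d"
      using pq(1,2) p q d by (auto simp: low_avoiders_def)
    have u: "map ((+) d) u = map ((+) d) u'"
      using tw[OF v(1), of u] tw[OF v(2), of u'] eq by simp
    then have "u = u'" by (simp add: inj_map_eq_map)
    moreover from u eq have "v = v'" by simp
    moreover have "k = length u" "k' = length u'"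
      using pq(1,2) p q by (auto simp: bounded_avoiders_def)
    ultimately show "p = q" using p q d by simp
  qed
  show "?f ` ?S = bounded_avoiders \<beta> (Suc n)"
  proof
    show "?f ` ?S \<subseteq> bounded_avoiders \<beta> (Suc n)"
    proof (rule image_subsetI)
      fix p assume pS: "p \<in> ?S"
      obtain d k u v where p: "p = ((d, k), (u, v))" by (metis surj_pair)
      have d: "d \<le> \<beta> 0" and k: "k \<le> n" and lu: "length u = k" and lv: "length v = n - k"
        and u: "avoids102 u" "\<forall>i<k. u ! i \<le> \<beta> (Suc i) - d"
        and v: "avoids102 v" "\<forall>x\<in>set v. x \<le> d" "v = [] \<or> hd v < d"
        using pS p unfolding low_avoiders_def bounded_avoiders_const
        by (auto simp: bounded_avoiders_def)
      have \<beta>: "d \<le> \<beta> i" for i using d monoD[OF assms, of 0 i] by simp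
      have "avoids102 (d # map ((+) d) u @ v)"
        using u v by (subst avoids102_decompose) (auto simp: avoids102_map_add)
      moreover have "(d # map ((+) d) u @ v) ! i \<le> \<beta> i" if "i < Suc n" for i
      proof (cases i)
        case 0
        with d show ?thesis by simp
      next
        case (Suc j)
        show ?thesis
        proof (cases "j < k")
          case True
          with u(2) lu Suc \<beta>[of "Suc j"] show ?thesis by (auto simp: nth_append)
        next
          case False
          then have "v ! (j - k) \<in> set v" using lv Suc that k by (intro nth_mem) auto
          with v(2) \<beta>[of i] False lu Suc show ?thesis by (auto simp: nth_append)
        qed
      qed
      ultimately show "?f p \<in> bounded_avoiders \<beta> (Suc n)"
        using p lu lv k by (auto simp: bounded_avoiders_def)
    qed
    show "bounded_avoiders \<beta> (Suc n) \<subseteq> ?f ` ?S"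
    proof
      fix w assume w: "w \<in> bounded_avoiders \<beta> (Suc n)"
      then obtain d w' where w': "w = d # w'"
        by (cases w) (auto simp: bounded_avoiders_def)
      define u v where "u = takeWhile (\<lambda>x. d \<le> x) w'" and "v = dropWhile (\<lambda>x. d \<le> x) w'"
      have wuv: "w = d # u @ v" using w' by (simp add: u_def v_def)
      have u: "\<forall>x\<in>set u. d \<le> x" by (auto simp: u_def dest: set_takeWhileD)
      have v: "v = [] \<or> hd v < d"
        using hd_dropWhile[of "\<lambda>x. d \<le> x" w'] unfolding v_def not_le by blast
      have av: "avoids102 u" "avoids102 v" "\<forall>x\<in>set v. x \<le> d"
        using w wuv avoids102_decompose[OF u v] by (auto simp: bounded_avoiders_def)
      have len: "length u + length v = n" using w wuv by (auto simp: bounded_avoiders_def)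
      have bd: "w ! i \<le> \<beta> i" if "i < Suc n" for i
        using w that by (auto simp: bounded_avoiders_def)
      have d: "d \<le> \<beta> 0" using bd[of 0] wuv by simp
      define u' where "u' = map (\<lambda>x. x - d) u"
      have uu': "u = map ((+) d) u'" using u by (auto simp: u'_def map_idI)
      have "u' ! i \<le> \<beta> (Suc i) - d" if "i < length u" for i
        using bd[of "Suc i"] that len wuv by (auto simp: u'_def nth_append)
      moreover have "avoids102 u'" using av(1) uu' avoids102_map_add by metis
      ultimately have "u' \<in> bounded_avoiders (\<lambda>i. \<beta> (Suc i) - d) (length u)"
        by (auto simp: bounded_avoiders_def u'_def)
      moreover have "v \<in> low_avoiders d (n - length u)"
        using av v len by (auto simp: low_avoiders_def bounded_avoiders_const)
      ultimately have "((d, length u), (u', v)) \<in> ?S"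
        using d len by auto
      moreover have "w = ?f ((d, length u), (u', v))"
        using wuv uu' by simp
      ultimately show "w \<in> ?f ` ?S" by (rule rev_image_eqI)
    qed
  qed
qed

lemma card_bounded_avoiders_Suc:
  assumes "mono \<beta>"
  shows "card (bounded_avoiders \<beta> (Suc n)) = (\<Sum>d\<le>\<beta> 0. \<Sum>k\<le>n.
    card (bounded_avoiders (\<lambda>i. \<beta> (Suc i) - d) k) * card (low_avoiders d (n - k)))"
proof -
  have "card (bounded_avoiders \<beta> (Suc n)) = card (SIGMA (d, k) : {..\<beta> 0} \<times> {..n}.
       bounded_avoiders (\<lambda>i. \<beta> (Suc i) - d) k \<times> low_avoiders d (n - k))"
    using bij_betw_same_card[OF bounded_avoiders_Suc_bij[OF assms]] by simp
  also have "\<dots> = (\<Sum>(d, k)\<in>{..\<beta> 0} \<times> {..n}.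
      card (bounded_avoiders (\<lambda>i. \<beta> (Suc i) - d) k \<times> low_avoiders d (n - k)))"
    by (subst card_SigmaI)
       (auto simp: finite_bounded_avoiders finite_low_avoiders intro!: sum.cong)
  finally show ?thesis
    by (simp add: sum.cartesian_product card_cartesian_product)
qed

section \<open>Recursion for the generating functions\<close>

definition avoider_gf :: "(nat \<Rightarrow> nat) \<Rightarrow> int fps" where
  "avoider_gf \<beta> = Abs_fps (\<lambda>n. int (card (bounded_avoiders \<beta> n)))"

lemma low_avoiders_gf:
  "Abs_fps (\<lambda>n. int (card (low_avoiders d n))) = (1 - fps_X) * avoider_gf (\<lambda>_. d)"
proof (rule fps_ext)
  fix n
  show "Abs_fps (\<lambda>n. int (card (low_avoiders d n))) $ n = ((1 - fps_X) * avoider_gf (\<lambda>_. d)) $ n"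
    by (cases n) (auto simp: avoider_gf_def low_avoiders_0 bounded_avoiders_0
        card_low_avoiders_Suc ring_distribs)
qed

lemma avoider_gf_rec:
  assumes "mono \<beta>"
  shows "avoider_gf \<beta> = 1 + fps_X * (1 - fps_X) *
    (\<Sum>d\<le>\<beta> 0. avoider_gf (\<lambda>i. \<beta> (Suc i) - d) * avoider_gf (\<lambda>_. d))"
proof -
  let ?V = "\<lambda>d. Abs_fps (\<lambda>n. int (card (low_avoiders d n)))"
  have "avoider_gf \<beta> = 1 + fps_X * (\<Sum>d\<le>\<beta> 0. avoider_gf (\<lambda>i. \<beta> (Suc i) - d) * ?V d)"
  proof (rule fps_ext)
    fix n
    show "avoider_gf \<beta> $ n =
      (1 + fps_X * (\<Sum>d\<le>\<beta> 0. avoider_gf (\<lambda>i. \<beta> (Suc i) - d) * ?V d)) $ n"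
    proof (cases n)
      case (Suc m)
      have "avoider_gf \<beta> $ Suc m = (\<Sum>d\<le>\<beta> 0. avoider_gf (\<lambda>i. \<beta> (Suc i) - d) * ?V d) $ m"
        by (simp add: avoider_gf_def fps_sum_nth fps_mult_nth
            card_bounded_avoiders_Suc[OF assms] atLeast0AtMost)
      with Suc show ?thesis by simp
    qed (simp add: avoider_gf_def bounded_avoiders_0)
  qed
  then show ?thesis
    by (simp add: low_avoiders_gf sum_distrib_left mult_ac)
qed

section \<open>Power series: the cubic root, uniqueness and the kernel method\<close>

text \<open>The recurrence of the numbers of ternary trees, read off from T = 1 + x T^3.\<close>

fun ternary :: "nat \<Rightarrow> int" where
  "ternary 0 = 1"
| "ternary (Suc n) = (\<Sum>i\<le>n. \<Sum>j\<le>n - i. ternary i * (ternary j * ternary (n - i - j)))"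

text \<open>Substituting \<open>t\<close> into the ternary tree series gives a root; composition
  respects products because \<open>t\<close> has no constant term.\<close>

lemma cubic_fps_exists:
  fixes t :: "int fps"
  assumes "t $ 0 = 0"
  obtains g where "g = 1 + t * g ^ 3"
proof -
  define T where "T = Abs_fps ternary"
  have T: "T = 1 + fps_X * T ^ 3"
  proof (rule fps_ext)
    fix n show "T $ n = (1 + fps_X * T ^ 3) $ n"
    proof (cases n)
      case (Suc m)
      have "T $ Suc m = (T ^ 3) $ m"
        by (simp add: T_def power3_eq_cube mult.assoc fps_mult_nth atLeast0AtMost
            sum_distrib_left)
      with Suc show ?thesis by simp
    qed (simp add: T_def)
  qed
  have "T oo t = (1 + fps_X * T ^ 3) oo t" using T by simp
  also have "\<dots> = 1 + t * (T oo t) ^ 3"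
    using assms by (simp add: fps_compose_add_distrib fps_compose_mult_distrib fps_compose_power)
  finally show ?thesis by (rule that)
qed

text \<open>The height may rise to \<open>Suc h\<close>, so induction on \<open>h\<close> fails. The
  factor \<open>fps_X\<close> makes coefficient \<open>n\<close> depend only on smaller indices, so
  the induction is on \<open>n\<close>, for all heights at once.\<close>

lemma fps_system_unique:
  fixes \<Delta> :: "nat \<Rightarrow> int fps"
  assumes "\<And>h. \<Delta> h = fps_X * (\<Sum>d\<le>h. c d * \<Delta> (Suc h - d))"
  shows "\<Delta> h = 0"
proof -
  have "\<Delta> h $ n = 0" for n
  proof (induction n arbitrary: h rule: less_induct)
    case (less n)
    have eq: "\<Delta> h $ n = (fps_X * (\<Sum>d\<le>h. c d * \<Delta> (Suc h - d))) $ n"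
      using assms[of h] by simp
    show ?case
    proof (cases n)
      case 0
      with eq show ?thesis by simp
    next
      case (Suc m)
      with eq have "\<Delta> h $ n = (\<Sum>d\<le>h. c d * \<Delta> (Suc h - d)) $ m" by simp
      also have "\<dots> = 0"
        using less.IH Suc by (simp add: fps_sum_nth fps_mult_nth)
      finally show ?thesis .
    qed
  qed
  then show ?thesis by (simp add: fps_ext)
qed

lemma fps_unit_exists:
  fixes a :: "'a :: comm_ring_1 fps"
  assumes "a $ 0 * u = 1"
  obtains b where "a * b = 1"
  using fps_right_inverse[OF assms] that by blast

text \<open>Kernel method: in power series over \<open>\<int>[[x]]\<close> in a catalytic variable \<open>y\<close> marking the
  height \<open>h\<close>, let \<open>p\<close> satisfy \<open>p (1 - p) (1 - y) = t\<close> and let \<open>z\<close> be the root of \<open>y = p(y)\<close>.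
  The quotient \<open>(y / (1 - y) - p / (1 - z)) / (y - p)\<close> is regular since both parts vanish at
  \<open>p = z\<close>; dividing out \<open>p - z\<close> gives the closed form of \<open>G\<close> below.\<close>

lemma kernel_solution:
  fixes p :: "int fps fps" and t g :: "int fps"
  assumes p: "p * (1 - p) * (1 - fps_X) = fps_const t"
    and g: "g = 1 + t * g ^ 3"
    and t: "t \<noteq> 0" "t $ 0 = 0" and p0: "p $ 0 $ 0 = 0"
  obtains G where "G $ 0 = g"
    "\<And>h. G $ h = 1 + (p * (G - fps_const g)) $ Suc h"
proof -
  \<comment> \<open>Setting both \<open>p\<close> and \<open>y\<close> to \<open>z\<close> in the
    equation for \<open>p\<close> gives z (1 - z)^2 = t, which this value satisfies because g (1 -
    z) = 1.\<close>
  define z where "z = t * g\<^sup>2"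
  have gz: "g * (1 - z) = 1"
  proof -
    have "g * (1 - z) = g - t * g ^ 3"
      by (simp add: z_def algebra_simps power2_eq_square power3_eq_cube)
    also have "\<dots> = 1" using g by (metis add_diff_cancel_right')
    finally show ?thesis .
  qed
  have "z * (1 - z)\<^sup>2 = t * (g * (1 - z))\<^sup>2"
    by (simp add: z_def power_mult_distrib)
  then have zt: "z * (1 - z)\<^sup>2 = t" by (simp add: gz)
  define y where "y = (fps_X :: int fps fps)"
  define Z where "Z = fps_const z"
  \<comment> \<open>\<open>D\<close> is the cofactor in p (1 - p)^2 - Z (1 - Z)^2 = (p - Z) D. Its
    innermost constant term is 1, so it is inverted first in \<open>x\<close>, then in
    \<open>y\<close>.\<close>
  define D where "D = 1 - 2 * (p + Z) + (p\<^sup>2 + p * Z + Z\<^sup>2)"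
  have z0: "z $ 0 = 0" using t by (simp add: z_def)
  have "D $ 0 $ 0 = 1"
    using p0 z0 by (simp add: D_def Z_def power2_eq_square numeral_fps_const)
  then obtain u where "D $ 0 * u = 1"
    using fps_unit_exists[of "D $ 0" 1] by auto
  then obtain D' where D': "D * D' = 1"
    using fps_unit_exists[of D u] by auto
  define J where "J = Abs_fps (\<lambda>_. 1 :: int fps)"
  have J: "J * (1 - y) = 1"
    by (rule fps_ext) (simp add: J_def y_def algebra_simps fps_eq_iff)
  define G where "G = (1 - p - 2 * Z + Z\<^sup>2) * D' * J"
  have rel: "p * (1 - p) * (1 - y) = Z * (1 - Z)\<^sup>2"
    unfolding y_def Z_def p zt[symmetric]
    by (metis fps_const_mult fps_const_power fps_const_sub fps_const_1_eq_1)
  \<comment> \<open>Multiplying by \<open>p * (1 - p)\<close> lets \<open>rel\<close> eliminate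
    \<open>y\<close>, which exposes the factor \<open>p - Z\<close>; the same happens in
    \<open>B\<close>.\<close>
  have A: "(y - p) * (p * (1 - p)) = (p - Z) * D"
  proof -
    have "(y - p) * (p * (1 - p)) = p * (1 - p)\<^sup>2 - p * (1 - p) * (1 - y)"
      by (simp add: algebra_simps power2_eq_square)
    also have "\<dots> = (p - Z) * D"
      unfolding rel D_def by (simp add: algebra_simps power2_eq_square)
    finally show ?thesis .
  qed
  have B: "(y * (1 - Z) - p * (1 - y)) * (p * (1 - p)) = (1 - Z) * (p - Z) * (1 - p - 2 * Z + Z\<^sup>2)"
  proof -
    have "(y * (1 - Z) - p * (1 - y)) * (p * (1 - p)) =
        (1 - Z) * (p * (1 - p)) - (1 - Z + p) * (p * (1 - p) * (1 - y))"
      by (simp add: algebra_simps)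
    also have "\<dots> = (1 - Z) * (p - Z) * (1 - p - 2 * Z + Z\<^sup>2)"
      unfolding rel by (simp add: algebra_simps power2_eq_square)
    finally show ?thesis .
  qed
  \<comment> \<open>Cross-multiplying \<open>A\<close> and \<open>B\<close> leaves only
    \<open>p * (1 - p)\<close> to cancel, which is nonzero because \<open>t\<close> is.\<close>
  have "p * (1 - p) \<noteq> 0" using p t by auto
  moreover have "(p * (1 - p)) * ((1 - Z) * (1 - p - 2 * Z + Z\<^sup>2) * (y - p)) =
      (p * (1 - p)) * ((y * (1 - Z) - p * (1 - y)) * D)"
  proof -
    have "(p * (1 - p)) * ((1 - Z) * (1 - p - 2 * Z + Z\<^sup>2) * (y - p)) =
        (1 - Z) * (1 - p - 2 * Z + Z\<^sup>2) * ((y - p) * (p * (1 - p)))"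
      by (simp only: mult_ac)
    also have "\<dots> = ((1 - Z) * (p - Z) * (1 - p - 2 * Z + Z\<^sup>2)) * D"
      unfolding A by (simp only: mult_ac)
    also have "\<dots> = (p * (1 - p)) * ((y * (1 - Z) - p * (1 - y)) * D)"
      unfolding B[symmetric] by (simp only: mult_ac)
    finally show ?thesis .
  qed
  ultimately have C: "(1 - Z) * (1 - p - 2 * Z + Z\<^sup>2) * (y - p) = (y * (1 - Z) - p * (1 - y)) * D"
    by simp
  have gZ: "fps_const g * (1 - Z) = 1"
    using gz unfolding Z_def by (metis fps_const_mult fps_const_sub fps_const_1_eq_1)
  have main: "G * (y - p) = y * J - p * fps_const g"
  proof -
    let ?g = "fps_const g"
    have "G * (y - p) = (?g * (1 - Z)) * (G * (y - p))" by (simp add: gZ)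
    also have "\<dots> = ?g * ((1 - Z) * (1 - p - 2 * Z + Z\<^sup>2) * (y - p)) * D' * J"
      unfolding G_def by (simp only: mult_ac)
    also have "\<dots> = (D * D') * ((?g * (1 - Z)) * (y * J) - ?g * p * (J * (1 - y)))"
      unfolding C by (simp add: algebra_simps)
    also have "\<dots> = y * J - p * ?g" unfolding D' gZ J by (simp add: mult.commute)
    finally show ?thesis .
  qed
  then have main': "y * G = y * J + p * (G - fps_const g)"
    by (simp add: algebra_simps)
  have step: "G $ h = 1 + (p * (G - fps_const g)) $ Suc h" for h
    using arg_cong[OF main', of "\<lambda>F. F $ Suc h"] by (simp add: y_def J_def)
  \<comment> \<open>The constant term in \<open>y\<close> forces the value at height 0, since p0 (1
    - p0) = t makes p0 = \<open>p $ 0\<close> nonzero.\<close>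
  have "p $ 0 * (G $ 0 - g) = 0"
    using arg_cong[OF main', of "\<lambda>F. F $ 0"] by (simp add: y_def)
  moreover have "p $ 0 \<noteq> 0"
    using arg_cong[OF p, of "\<lambda>F. F $ 0"] t by auto
  ultimately have "G $ 0 = g" by simp
  with step show ?thesis by (rule that[rotated])
qed

section \<open>Solving the system of functional equations\<close>

theorem theorem2p2:
  shows "w102_gf = 1 + fps_X * (1 - fps_X) * w102_gf ^ 3"
proof -
  define t :: "int fps" where "t = fps_X * (1 - fps_X)"
  define U where "U = (\<lambda>d. avoider_gf (\<lambda>_. d))"
  define F where "F = (\<lambda>h. avoider_gf (\<lambda>i. h + i))"
  have U: "U d = 1 + t * (\<Sum>e\<le>d. U e * U (d - e))" for d
    using avoider_gf_rec[of "\<lambda>_. d"] by (simp add: U_def t_def mono_def mult_ac)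
  have F: "F h = 1 + t * (\<Sum>d\<le>h. U d * F (Suc h - d))" for h
  proof -
    \<comment> \<open>Moving one position on raises the bound by one, and shifting lowers it by
      \<open>d\<close>, so the new height is \<open>Suc h - d\<close>.\<close>
    have eq: "(\<lambda>i. h + Suc i - d) = (\<lambda>i. Suc h - d + i)" if "d \<le> h" for d
      using that by auto
    have "(\<Sum>d\<le>h. avoider_gf (\<lambda>i. h + Suc i - d) * U d) = (\<Sum>d\<le>h. U d * F (Suc h - d))"
      by (intro sum.cong refl, subst eq) (simp_all add: F_def mult.commute)
    moreover have "mono (\<lambda>i. h + i)" by (simp add: mono_def)
    from avoider_gf_rec[OF this]
    have "F h = 1 + t * (\<Sum>d\<le>h. avoider_gf (\<lambda>i. h + Suc i - d) * U d)"
      by (simp only: F_def U_def t_def add_0_right)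
    ultimately show ?thesis by simp
  qed
  \<comment> \<open>Marking \<open>d\<close> by \<open>y\<close> turns the convolution for
    \<open>U\<close> into the quadratic p = t / (1 - y) + p^2, which is the kernel relation.\<close>
  define p where "p = fps_const t * Abs_fps U"
  have pn: "p $ d = t * U d" for d by (simp add: p_def)
  have "p = fps_const t * Abs_fps (\<lambda>_. 1) + p * p"
  proof (rule fps_ext)
    fix d
    have "t * U d = t + t * (t * (\<Sum>e\<le>d. U e * U (d - e)))"
      by (subst U) (simp add: algebra_simps)
    then show "p $ d = (fps_const t * Abs_fps (\<lambda>_. 1) + p * p) $ d"
      by (simp add: pn fps_mult_nth atLeast0AtMost sum_distrib_left mult_ac)
  qed
  then have "p * (1 - p) = fps_const t * Abs_fps (\<lambda>_. 1)"
    by (simp add: algebra_simps)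
  moreover have "Abs_fps (\<lambda>_. 1 :: int fps) * (1 - fps_X) = 1"
    by (rule fps_ext) (simp add: algebra_simps fps_eq_iff)
  ultimately have p: "p * (1 - p) * (1 - fps_X) = fps_const t"
    by (simp add: mult.assoc)
  have t0: "t $ 0 = 0" by (simp add: t_def)
  have "t $ 1 = 1" by (simp add: t_def algebra_simps)
  then have t: "t \<noteq> 0" by auto
  obtain g where g: "g = 1 + t * g ^ 3" using cubic_fps_exists[OF t0] by blast
  have "p $ 0 $ 0 = 0" by (simp add: pn t0)
  then obtain G where G: "G $ 0 = g" "\<And>h. G $ h = 1 + (p * (G - fps_const g)) $ Suc h"
    using kernel_solution[OF p g t t0] by blast
  \<comment> \<open>The sum stops at \<open>h\<close> because the term for \<open>d = Suc h\<close>
    carries \<open>G $ 0 - g = 0\<close>; in the others \<open>fps_const g\<close> contributes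
    nothing.\<close>
  have G': "G $ h = 1 + t * (\<Sum>d\<le>h. U d * G $ (Suc h - d))" for h
    by (subst G(2)) (simp add: fps_mult_nth atLeast0AtMost pn G(1) sum_distrib_left mult_ac Suc_diff_le)
  \<comment> \<open>\<open>F\<close> and \<open>G\<close> solve the same inhomogeneous system, so
    their difference solves the homogeneous one.\<close>
  have "F h - G $ h = fps_X * (\<Sum>d\<le>h. ((1 - fps_X) * U d) * (F (Suc h - d) - G $ (Suc h - d)))" for h
    by (subst F, subst G') (simp add: t_def sum_distrib_left sum_subtractf sum.distrib algebra_simps)
  then have "F 0 - G $ 0 = 0" by (rule fps_system_unique)
  moreover have "F 0 = w102_gf"
  proof -
    have "(+) 0 = (\<lambda>i::nat. i)" by auto
    then show ?thesis
      unfolding F_def avoider_gf_def w102_gf_def w102_def weak_ascent_avoiders_102 by simp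
  qed
  ultimately show ?thesis using g G(1) by (simp add: t_def)
qed

end
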